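(* Let $f\colon(0,\infty)\to\mathbb{R}$ be a differentiable function such that $$f(b)-f(a)=(b-a)\,f'\bigl(\sqrt{ab}\bigr)\quad\text{for all } a,b>0.$$ Then there exist constants $c_1,c_2,c_3\in\mathbb{R}$ such that $$f(x)=\frac{c_1}{x}+c_2x+c_3\quad\text{for all } x>0.$$ *)

theory Defs
  imports "HOL-Analysis.Analysis"
begin

end

theory Submission
  imports Defs
begin

text \<open>
  Write \<open>k x = x * deriv f x\<close>.  Taking \<open>a = x / t\<close> and \<open>b = x * t\<close> turns the hypothesis into
  \<open>f (x * t) - f (x / t) = (t - 1 / t) * k x\<close>: an increment of \<open>f\<close> over an interval is determined
  by \<open>k\<close> at its geometric midpoint.  Cutting one interval around \<open>x\<close> into three pieces, the middle
  one again centred at \<open>x\<close>, eliminates \<open>f\<close> and leaves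
  \<open>k (x * t) + k (x / t) = (t + 1 / t) * k x\<close>.  In logarithmic coordinates \<open>x = exp u\<close> this is
  d'Alembert's equation \<open>k (u + s) + k (u - s) = 2 * cosh s * k u\<close>, whose solutions are
  the combinations of \<open>exp u\<close> and \<open>exp (- u)\<close>, that is, \<open>k x = A * x + B / x\<close>.  No calculus enters:
  a solution is fixed by its values at the two points \<open>1\<close> and \<open>2\<close>.  The increment of \<open>f\<close> from \<open>1\<close>
  to \<open>x\<close>, whose geometric midpoint is \<open>sqrt x\<close>, then gives \<open>f x\<close> in closed form without integration.
\<close>

text \<open>
  In logarithmic coordinates, the interval of half-length \<open>log t + log 2\<close> centred at \<open>x\<close> splits into
  the concentric interval of half-length \<open>log t - log 2\<close> and two intervals of half-length \<open>log 2\<close>,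
  centred at \<open>x * t\<close> and \<open>x / t\<close>.  Adding up the three increments makes \<open>f\<close> cancel;
  increments are oriented, so nothing changes when \<open>t < 2\<close>.
\<close>

lemma geometric_midpoint_dAlembert:
  fixes f k :: "real \<Rightarrow> real"
  assumes incr: "\<And>x t. x > 0 \<Longrightarrow> t > 0 \<Longrightarrow> f (x * t) - f (x / t) = (t - 1 / t) * k x"
    and "x > 0" "t > 0"
  shows "k (x * t) + k (x / t) = (t + 1 / t) * k x"
proof -
  have whole: "f (x * t * 2) - f (x / t / 2) = (t * 2 - 1 / (t * 2)) * k x"
    using incr[of x "t * 2"] assms(2,3) by (simp add: mult.assoc)
  have middle: "f (x * t / 2) - f (x / t * 2) = (t / 2 - 2 / t) * k x"
    using incr[of x "t / 2"] assms(2,3) by simp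
  have right: "f (x * t * 2) - f (x * t / 2) = 3 / 2 * k (x * t)"
    using incr[of "x * t" 2] assms(2,3) by simp
  have left: "f (x / t * 2) - f (x / t / 2) = 3 / 2 * k (x / t)"
    using incr[of "x / t" 2] assms(2,3) by simp
  have "(3 / 2) * (k (x * t) + k (x / t)) =
      (t * 2 - 1 / (t * 2)) * k x - (t / 2 - 2 / t) * k x"
    unfolding distrib_left whole[symmetric] middle[symmetric] right[symmetric] left[symmetric]
    by (simp only: algebra_simps)
  also have "\<dots> = (t * 2 - 1 / (t * 2) - (t / 2 - 2 / t)) * k x"
    by (rule left_diff_distrib[symmetric])
  also have "t * 2 - 1 / (t * 2) - (t / 2 - 2 / t) = (3 / 2) * (t + 1 / t)"
    using assms(3) by (simp add: field_simps)
  finally have "(3 / 2) * (k (x * t) + k (x / t)) = (3 / 2) * ((t + 1 / t) * k x)"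
    by (simp only: mult.assoc)
  then show ?thesis
    unfolding mult_cancel_left by simp
qed

text \<open>
  A zero at \<open>1\<close> makes \<open>k\<close> odd under \<open>x \<mapsto> 1 / x\<close>, so exchanging the two variables in the equation
  flips the sign of one term, and the values at \<open>x * t\<close> and \<open>x / t\<close> separate into an addition and a
  subtraction formula, as for \<open>sinh\<close>.  With a second zero at \<open>2\<close>, these say that both doubling and
  halving the argument multiply \<open>k\<close> by \<open>5 / 4\<close>.  Since the two moves undo each other, \<open>k\<close> must
  vanish.
\<close>

lemma dAlembert_two_zeros:
  fixes k :: "real \<Rightarrow> real"
  assumes eq: "\<And>x t. x > 0 \<Longrightarrow> t > 0 \<Longrightarrow> k (x * t) + k (x / t) = (t + 1 / t) * k x"
    and "k 1 = 0" "k 2 = 0" "x > 0"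
  shows "k x = 0"
proof -
  have odd: "k (1 / y) = - k y" if "y > 0" for y
    using eq[of 1 y] that assms(2) by simp
  have double: "k (y * 2) = 5 / 4 * k y" and half: "k (y / 2) = 5 / 4 * k y" if "y > 0" for y
  proof -
    have "k (y * 2) + k (y / 2) = 5 / 2 * k y"
      using eq[of y 2] that by simp
    moreover have "k (y * 2) - k (y / 2) = 0"
      using eq[of 2 y] odd[of "y / 2"] that assms(3) by (simp add: mult.commute)
    ultimately show "k (y * 2) = 5 / 4 * k y" "k (y / 2) = 5 / 4 * k y" by simp_all
  qed
  have "k x = 5 / 4 * (5 / 4 * k x)"
    using double[of "x / 2"] half[of x] assms(4) by simp
  then show ?thesis by simp
qed

lemma dAlembert_solutions:
  fixes k :: "real \<Rightarrow> real"
  assumes eq: "\<And>x t. x > 0 \<Longrightarrow> t > 0 \<Longrightarrow> k (x * t) + k (x / t) = (t + 1 / t) * k x"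
  obtains A B where "\<And>x. x > 0 \<Longrightarrow> k x = A * x + B / x"
proof -
  \<comment> \<open>The solution of \<open>A + B = k 1\<close> and \<open>2 * A + B / 2 = k 2\<close>, which makes the difference below
     vanish at both points.\<close>
  define A where "A = (2 * k 2 - k 1) / 3"
  define B where "B = (4 * k 1 - 2 * k 2) / 3"
  define d where "d y = k y - (A * y + B / y)" for y
  have "d (x * t) + d (x / t) = (t + 1 / t) * d x" if "x > 0" "t > 0" for x t
  proof -
    have "A * (x * t) + B / (x * t) + (A * (x / t) + B / (x / t)) = (t + 1 / t) * (A * x + B / x)"
      using that by (simp add: field_simps)
    then show ?thesis
      using eq[OF that] by (simp add: d_def right_diff_distrib)
  qed
  moreover have "d 1 = 0" "d 2 = 0"
    by (simp_all add: d_def A_def B_def field_simps)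
  ultimately have "d x = 0" if "x > 0" for x
    using dAlembert_two_zeros[of d] that by blast
  then show ?thesis
    using that[of A B] by (simp add: d_def)
qed

theorem corollary2:
  fixes f :: "real \<Rightarrow> real"
  assumes "f differentiable_on {0<..}"
    and "\<And>a b. a > 0 \<Longrightarrow> b > 0 \<Longrightarrow> f b - f a = (b - a) * deriv f (sqrt (a * b))"
  shows "\<exists>c1 c2 c3. \<forall>x>0. f x = c1 / x + c2 * x + c3"
proof -
  define k where "k x = x * deriv f x" for x
  have incr: "f (x * t) - f (x / t) = (t - 1 / t) * k x" if "x > 0" "t > 0" for x t
  proof -
    have "sqrt (x / t * (x * t)) = x"
      using that by simp
    moreover have "x * t - x / t = (t - 1 / t) * x"
      by (simp add: field_simps)
    ultimately show ?thesis
      using assms(2)[of "x / t" "x * t"] that by (simp add: k_def)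
  qed
  obtain A B where k: "\<And>x. x > 0 \<Longrightarrow> k x = A * x + B / x"
    using dAlembert_solutions[of k] geometric_midpoint_dAlembert[OF incr] by blast
  have "f x = - B / x + A * x + (f 1 + B - A)" if "x > 0" for x
  proof -
    define y where "y = sqrt x"
    have y: "y > 0" "x = y * y"
      using that by (simp_all add: y_def)
    have "f x - f 1 = (y - 1 / y) * (A * y + B / y)"
      using incr[of y y] k[of y] y by simp
    also have "\<dots> = - B / x + A * x + (B - A)"
      using y by (simp add: field_simps)
    finally show ?thesis by simp
  qed
  then show ?thesis by blast
qed

end
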